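(* For each integer $n\ge 2$ write $N=n-1$, and let $\widehat p_n$, $\varphi$, $\Phi$ be as in the context. Let $\widehat F_n(x):=\int_{-x}^{x}\widehat p_n(z)\,dz$ for $x\ge 0$. Then for every fixed $x\ge0$, as $n\to\infty$, $$N\left[\widehat F_n(x)-\bigl(2\Phi(x)-1\bigr)\right]\longrightarrow\widehat H(x):=\frac{x^3-3x}{2}\,\varphi(x).$$ Furthermore, with $$b_-:=\sqrt{3-\sqrt6},\qquad b_+:=\sqrt{3+\sqrt6},$$ one has, as $n\to\infty$, $$N\,d_{\rm TV}(\widehat p_n,\varphi)\longrightarrow\widehat C_{\rm TV}:=\frac{\sqrt6}{2}\bigl[b_-\varphi(b_-)+b_+\varphi(b_+)\bigr]\approx0.350075038.$$
   Context: $\varphi(z)=(2\pi)^{-1/2}e^{-z^2/2}$ and $\Phi(x)=\int_{-\infty}^x\varphi(y)\,dy$. For probability densities $p,q$ on $\mathbb{R}$, $d_{\rm TV}(p,q)=\frac12\int_{\mathbb{R}}|p(y)-q(y)|\,dy$. For $n\ge2$ and $N=n-1$, let $$h_N(y)=\begin{cases}\left(1-\frac{y^2}{N}\right)^{N/2}, & |y|\le\sqrt N,\\ 0,& |y|>\sqrt N,\end{cases}\qquad D_N=\int_{\mathbb{R}}h_N(y)\,dy,\qquad p_n(y)=\frac{h_N(y)}{D_N},$$ and $$\kappa_n=\sqrt{\frac{N}{N+3}},\qquad \widehat p_n(z)=\kappa_n\,p_n(\kappa_n z),\quad z\in\mathbb{R}.$$ *)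

theory Defs
  imports "HOL-Probability.Probability"
begin

text \<open>The density \<open>\<phi>\<close> is the library's \<^const>\<open>std_normal_density\<close>.\<close>

definition Phi :: "real \<Rightarrow> real" where
  "Phi x = (LBINT y:{..x}. std_normal_density y)"

definition d_TV :: "(real \<Rightarrow> real) \<Rightarrow> (real \<Rightarrow> real) \<Rightarrow> real" where
  "d_TV p q = 1 / 2 * (LBINT y. \<bar>p y - q y\<bar>)"

text \<open>
  The functions \<open>h\<close> and \<open>D\<close> are indexed by \<open>N\<close>, while \<open>p\<close>, \<open>kappa\<close>, \<open>p_hat\<close> and \<open>F_hat\<close> are
  indexed by \<open>n = N + 1\<close>; these have their intended meaning for \<open>N \<ge> 1\<close> and \<open>n \<ge> 2\<close>.
  At \<open>\<bar>y\<bar> = sqrt N\<close> the value \<open>0 powr (N / 2)\<close> is \<open>0\<close>, as it should be.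
\<close>

definition h :: "nat \<Rightarrow> real \<Rightarrow> real" where
  "h N y = (if \<bar>y\<bar> \<le> sqrt (real N) then (1 - y\<^sup>2 / real N) powr (real N / 2) else 0)"

definition D :: "nat \<Rightarrow> real" where
  "D N = (LBINT y. h N y)"

definition p :: "nat \<Rightarrow> real \<Rightarrow> real" where
  "p n y = h (n - 1) y / D (n - 1)"

definition kappa :: "nat \<Rightarrow> real" where
  "kappa n = sqrt (real (n - 1) / (real (n - 1) + 3))"

definition p_hat :: "nat \<Rightarrow> real \<Rightarrow> real" where
  "p_hat n z = kappa n * p n (kappa n * z)"

definition F_hat :: "nat \<Rightarrow> real \<Rightarrow> real" where
  "F_hat n x = (LBINT z:{- x..x}. p_hat n z)"

definition H_hat :: "real \<Rightarrow> real" where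
  "H_hat x = (x ^ 3 - 3 * x) / 2 * std_normal_density x"

definition b_minus :: real where
  "b_minus = sqrt (3 - sqrt 6)"

definition b_plus :: real where
  "b_plus = sqrt (3 + sqrt 6)"

definition C_TV_hat :: real where
  "C_TV_hat = sqrt 6 / 2 *
     (b_minus * std_normal_density b_minus + b_plus * std_normal_density b_plus)"

end

theory Submission
  imports Defs "HOL-Real_Asymp.Real_Asymp"
begin

text \<open>
  With \<open>N = n - 1\<close>, rescaling turns \<open>p_hat n\<close> into the normalisation of
  \<open>(1 - z\<^sup>2 / (N + 3)) powr (N / 2)\<close>. Expanding the logarithm, \<open>N\<close> times the difference of this kernel
  and \<open>exp (- z\<^sup>2 / 2)\<close> tends to \<open>exp (- z\<^sup>2 / 2) * (3 / 2 * z\<^sup>2 - z ^ 4 / 4)\<close>, and it is dominated by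
  \<open>exp (- z\<^sup>2 / 8) * (4 * z\<^sup>2 + z ^ 4)\<close>. After normalisation the first-order error of the density is
  \<open>- \<phi> * He\<^sub>4 / 4\<close> with the Hermite polynomial \<open>He\<^sub>4 = z ^ 4 - 6 * z\<^sup>2 + 3\<close>, whose positive roots are
  \<open>b_minus\<close> and \<open>b_plus\<close>. By dominated convergence both limits are integrals of this function, and
  \<open>\<phi> * He\<^sub>3 / 4\<close> is an antiderivative.
\<close>

subsection \<open>The rescaled kernel\<close>

definition h_hat :: "nat \<Rightarrow> real \<Rightarrow> real" where
  "h_hat N z = h N (kappa (Suc N) * z)"

lemma kappa_pos: "0 < N \<Longrightarrow> 0 < kappa (Suc N)"
  by (simp add: kappa_def)

text \<open>Since \<open>kappa (Suc N)\<close> squared over \<open>N\<close> equals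
  \<open>1 / (N + 3)\<close>, the rescaling replaces \<open>N\<close> by \<open>N + 3\<close> in the
  base and in the support, but leaves the exponent \<open>N / 2\<close> alone.\<close>

lemma h_hat_eq:
  assumes "0 < N"
  shows "h_hat N z = (if z\<^sup>2 \<le> real N + 3 then (1 - z\<^sup>2 / (real N + 3)) powr (real N / 2) else 0)"
proof -
  have sq: "(kappa (Suc N) * z)\<^sup>2 = real N * z\<^sup>2 / (real N + 3)"
    by (simp add: kappa_def power_mult_distrib)
  have "\<bar>kappa (Suc N) * z\<bar> \<le> sqrt (real N) \<longleftrightarrow> (kappa (Suc N) * z)\<^sup>2 \<le> real N"
    by (metis real_sqrt_abs real_sqrt_le_iff)
  also have "\<dots> \<longleftrightarrow> z\<^sup>2 \<le> real N + 3"
    using assms mult_le_cancel_left_pos[of "real N" "z\<^sup>2" "real N + 3"]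
    unfolding sq by (simp add: field_simps)
  finally show ?thesis
    using assms unfolding h_hat_def h_def sq by simp
qed

lemma h_hat_nonneg: "0 \<le> h_hat N z"
  by (simp add: h_hat_def h_def)

lemma borel_measurable_h_hat [measurable]: "h_hat N \<in> borel_measurable borel"
  unfolding h_hat_def[abs_def] h_def[abs_def] by measurable

text \<open>The substitution y = kappa z in \<open>D N\<close> produces a Jacobian
  \<open>kappa (Suc N)\<close>, which cancels the prefactor of \<open>p_hat\<close>.\<close>

lemma p_hat_eq:
  assumes "0 < N"
  shows "p_hat (Suc N) z = h_hat N z / (LBINT y. h_hat N y)"
proof -
  have "D N = kappa (Suc N) * (LBINT y. h_hat N y)"
    using lborel_integral_real_affine[of "kappa (Suc N)" "h N" 0] kappa_pos[OF assms]
    by (simp add: D_def h_hat_def)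
  then show ?thesis
    using kappa_pos[OF assms] by (simp add: p_hat_def p_def h_hat_def)
qed

section \<open>Error of the kernel: uniform bounds and pointwise limit\<close>

lemma h_hat_upper:
  assumes N: "0 < N"
  shows "real N * (h_hat N z - exp (- z\<^sup>2 / 2)) \<le> exp (- z\<^sup>2 / 8) * (4 * z\<^sup>2)"
proof (cases "z\<^sup>2 < real N + 3")
  case True
  define M where "M = real N + 3"
  have M: "M > 0" "real N \<ge> 1" "real N \<le> M" using N by (auto simp: M_def)
  have t: "z\<^sup>2 / M < 1" using True M by (simp add: M_def)
  have "h_hat N z = exp (real N / 2 * ln (1 - z\<^sup>2 / M))"
    using True t M by (simp add: h_hat_eq[OF N] powr_def M_def)
  \<comment> \<open>By ln (1 - t) <= - t the kernel lies below a Gaussian of slightly larger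
    variance.\<close>
  also have "\<dots> \<le> exp (real N / 2 * (- (z\<^sup>2 / M)))"
    unfolding exp_le_cancel_iff
    using t ln_le_minus_one[of "1 - z\<^sup>2 / M"] by (intro mult_left_mono) auto
  finally have 1: "h_hat N z \<le> exp (- (real N * z\<^sup>2 / (2 * M)))" (is "_ \<le> exp ?a") by simp
  \<comment> \<open>With u = \<open>?a + z\<^sup>2 / 2\<close>, the inequality 1 - exp (- u) <= u
    gains the factor 1 / M that compensates the multiplication by N.\<close>
  have "exp ?a - exp (- z\<^sup>2 / 2) = exp ?a * (1 - exp (- z\<^sup>2 / 2 - ?a))"
    by (simp add: algebra_simps flip: exp_add)
  also have "\<dots> \<le> exp ?a * (?a + z\<^sup>2 / 2)"
  proof (intro mult_left_mono)
    show "1 - exp (- z\<^sup>2 / 2 - ?a) \<le> ?a + z\<^sup>2 / 2"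
      using exp_ge_add_one_self[of "- z\<^sup>2 / 2 - ?a"] by linarith
  qed simp
  also have "?a + z\<^sup>2 / 2 = 3 * z\<^sup>2 / (2 * M)"
    using M(1) by (simp add: M_def field_simps)
  also have "exp ?a * (3 * z\<^sup>2 / (2 * M)) \<le> exp (- z\<^sup>2 / 8) * (3 * z\<^sup>2 / (2 * M))"
  proof -
    \<comment> \<open>N >= 1 gives N + 3 <= 4 N; this is the origin of the 8 in the
      majorant.\<close>
    have "M * z\<^sup>2 \<le> 4 * real N * z\<^sup>2"
      using M by (intro mult_right_mono) (auto simp: M_def)
    then have "?a \<le> - z\<^sup>2 / 8" using M by (simp add: field_simps)
    then show ?thesis using M by (intro mult_right_mono) auto
  qed
  finally have "h_hat N z - exp (- z\<^sup>2 / 2) \<le> exp (- z\<^sup>2 / 8) * (3 * z\<^sup>2 / (2 * M))"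
    using 1 by linarith
  then have "real N * (h_hat N z - exp (- z\<^sup>2 / 2)) \<le> real N * (exp (- z\<^sup>2 / 8) * (3 * z\<^sup>2 / (2 * M)))"
    by (intro mult_left_mono) auto
  also have "\<dots> = exp (- z\<^sup>2 / 8) * (real N / M * (3 / 2 * z\<^sup>2))" by (simp add: algebra_simps)
  also have "\<dots> \<le> exp (- z\<^sup>2 / 8) * (1 * (4 * z\<^sup>2))"
    using M by (intro mult_left_mono mult_mono) auto
  finally show ?thesis by simp
next
  case False
  then have "h_hat N z = 0" using N by (auto simp: h_hat_eq)
  moreover have "- (real N * exp (- z\<^sup>2 / 2)) \<le> 0" by simp
  moreover have "0 \<le> exp (- z\<^sup>2 / 8) * (4 * z\<^sup>2)" by simp
  ultimately show ?thesis by (simp only: diff_0 mult_minus_right)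
qed

text \<open>Where t = z^2 / (N + 3) <= 1 / 2, the bound ln (1 - t) >= - t - 2 t^2 costs a term of
  order z^4 / N. For larger z even the trivial bound 0 on the kernel is enough, because N is then at
  most a multiple of z^2.\<close>

lemma h_hat_lower:
  assumes N: "0 < N"
  shows "real N * (exp (- z\<^sup>2 / 2) - h_hat N z) \<le> exp (- z\<^sup>2 / 2) * (4 * z\<^sup>2 + z ^ 4)"
proof (cases "z\<^sup>2 \<le> (real N + 3) / 2")
  case True
  define M where "M = real N + 3"
  have M: "M > 0" "real N \<ge> 1" "real N \<le> M" using N by (auto simp: M_def)
  have t: "z\<^sup>2 / M \<le> 1 / 2" using True M by (simp add: M_def field_simps)
  have "exp (- z\<^sup>2 / 2 - z ^ 4 / M) \<le> exp (real N / 2 * (- (z\<^sup>2 / M) - 2 * (z\<^sup>2 / M)\<^sup>2))"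
  proof -
    have "real N / M * z\<^sup>2 \<le> 1 * z\<^sup>2" "real N / M * (z ^ 4 / M) \<le> 1 * (z ^ 4 / M)"
      using M by (intro mult_right_mono; simp)+
    then have "- (z\<^sup>2) / 2 - z ^ 4 / M \<le> - (real N / M * z\<^sup>2) / 2 - real N / M * (z ^ 4 / M)"
      by (intro diff_mono divide_right_mono) auto
    also have "\<dots> = real N / 2 * (- (z\<^sup>2 / M) - 2 * (z\<^sup>2 / M)\<^sup>2)"
      using M by (simp add: field_simps power2_eq_square power4_eq_xxxx)
    finally show ?thesis by simp
  qed
  also have "\<dots> \<le> exp (real N / 2 * ln (1 - z\<^sup>2 / M))"
    using t M ln_one_minus_pos_lower_bound[of "z\<^sup>2 / M"] by (simp add: mult_left_mono)
  also have "\<dots> = h_hat N z"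
    using True t M by (simp add: h_hat_eq[OF N] powr_def M_def)
  finally have "exp (- z\<^sup>2 / 2) * exp (- (z ^ 4 / M)) \<le> h_hat N z"
    by (simp flip: exp_add)
  then have "exp (- z\<^sup>2 / 2) - h_hat N z \<le> exp (- z\<^sup>2 / 2) * (1 - exp (- (z ^ 4 / M)))"
    by (simp add: right_diff_distrib)
  also have "\<dots> \<le> exp (- z\<^sup>2 / 2) * (z ^ 4 / M)"
    using exp_ge_add_one_self[of "- (z ^ 4 / M)"] by (intro mult_left_mono) auto
  finally have "real N * (exp (- z\<^sup>2 / 2) - h_hat N z) \<le> real N * (exp (- z\<^sup>2 / 2) * (z ^ 4 / M))"
    by (intro mult_left_mono) auto
  also have "\<dots> = exp (- z\<^sup>2 / 2) * (real N / M * z ^ 4)" by simp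
  also have "\<dots> \<le> exp (- z\<^sup>2 / 2) * (1 * z ^ 4)"
    using M by (intro mult_left_mono mult_right_mono) auto
  also have "\<dots> \<le> exp (- z\<^sup>2 / 2) * (4 * z\<^sup>2 + z ^ 4)"
    by (intro mult_left_mono) auto
  finally show ?thesis .
next
  case False
  have "real N * (exp (- z\<^sup>2 / 2) - h_hat N z) \<le> real N * exp (- z\<^sup>2 / 2)"
    using h_hat_nonneg by (intro mult_left_mono) auto
  also have "\<dots> = exp (- z\<^sup>2 / 2) * real N" by simp
  also have "\<dots> \<le> exp (- z\<^sup>2 / 2) * (4 * z\<^sup>2 + z ^ 4)"
  proof (intro mult_left_mono)
    have "real N \<le> 4 * z\<^sup>2" using False by (simp add: field_simps)
    also have "\<dots> \<le> 4 * z\<^sup>2 + z ^ 4" by simp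
    finally show "real N \<le> \<dots>" .
  qed auto
  finally show ?thesis .
qed

lemma h_hat_bound:
  assumes N: "0 < N"
  shows "\<bar>real N * (h_hat N z - exp (- z\<^sup>2 / 2))\<bar> \<le> exp (- z\<^sup>2 / 8) * (4 * z\<^sup>2 + z ^ 4)"
proof -
  have "exp (- z\<^sup>2 / 8) * (4 * z\<^sup>2) \<le> exp (- z\<^sup>2 / 8) * (4 * z\<^sup>2 + z ^ 4)"
    by (intro mult_left_mono) auto
  moreover have "exp (- z\<^sup>2 / 2) * (4 * z\<^sup>2 + z ^ 4) \<le> exp (- z\<^sup>2 / 8) * (4 * z\<^sup>2 + z ^ 4)"
    by (intro mult_right_mono) auto
  ultimately show ?thesis
    using h_hat_upper[OF N, of z] h_hat_lower[OF N, of z] unfolding abs_le_iff right_diff_distrib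
    by linarith
qed

lemma h_hat_pointwise:
  "(\<lambda>N. real N * (h_hat N z - exp (- z\<^sup>2 / 2)))
     \<longlonglongrightarrow> exp (- z\<^sup>2 / 2) * (3 / 2 * z\<^sup>2 - z ^ 4 / 4)"
proof -
  define c where "c = z\<^sup>2"
  have c: "c \<ge> 0" by (simp add: c_def)
  have "((\<lambda>x::real. x * ((1 - c / (x + 3)) powr (x / 2) - exp (- c / 2)))
      \<longlongrightarrow> exp (- c / 2) * (3 / 2 * c - c\<^sup>2 / 4)) at_top"
  \<comment> \<open>For c = 0 the expression vanishes identically; for c > 0 the known sign of c
    lets the asymptotic expansion be computed.\<close>
  proof (cases "c = 0")
    case True
    have "\<forall>\<^sub>F x::real in at_top. x * ((1 - c / (x + 3)) powr (x / 2) - exp (- c / 2)) = 0"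
      using True by (intro always_eventually) simp
    then show ?thesis using True by (simp add: tendsto_eventually)
  next
    case False
    then have "c > 0" using c by simp
    then show ?thesis by (real_asymp simp: field_simps power2_eq_square exp_minus)
  qed
  then have lim: "(\<lambda>N. real N * ((1 - c / (real N + 3)) powr (real N / 2) - exp (- c / 2)))
      \<longlonglongrightarrow> exp (- c / 2) * (3 / 2 * c - c\<^sup>2 / 4)"
    by (rule filterlim_compose[OF _ filterlim_real_sequentially])
  \<comment> \<open>Once N >= c the point z lies in the support, so the closed form is the kernel
    itself.\<close>
  have "\<forall>\<^sub>F N in sequentially. real N \<ge> c" by real_asymp
  then have "\<forall>\<^sub>F N in sequentially.
      real N * ((1 - c / (real N + 3)) powr (real N / 2) - exp (- c / 2))
      = real N * (h_hat N z - exp (- z\<^sup>2 / 2))"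
    using eventually_gt_at_top[of 0] by eventually_elim (simp add: h_hat_eq c_def)
  then show ?thesis
    using Lim_transform_eventually[OF lim] by (simp add: c_def power2_eq_square power4_eq_xxxx mult.assoc)
qed


section \<open>Gaussian integrals\<close>

lemma exp_eq_std_normal_density: "exp (- z\<^sup>2 / 2) = sqrt (2 * pi) * std_normal_density z"
  by (simp add: std_normal_density_def)

lemma integrable_exp_minus_square: "integrable lborel (\<lambda>z::real. exp (- z\<^sup>2 / 2))"
  unfolding exp_eq_std_normal_density by simp

text \<open>Up to a constant, exp (- z^2 / 8) is the normal density with standard deviation 2, so
  the majorant is a combination of its moments.\<close>

lemma integrable_dominating: "integrable lborel (\<lambda>z::real. exp (- z\<^sup>2 / 8) * (4 * z\<^sup>2 + z ^ 4))"
proof -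
  have "exp (- z\<^sup>2 / 8) * (4 * z\<^sup>2 + z ^ 4) =
      sqrt (8 * pi) * (4 * (normal_density 0 2 z * z\<^sup>2) + normal_density 0 2 z * z ^ 4)" for z :: real
    by (simp add: normal_density_def field_simps)
  moreover have "integrable lborel (\<lambda>z. normal_density 0 2 z * z ^ k)" for k
    using integrable_normal_moment[of 2 0 k] by simp
  ultimately show ?thesis by simp
qed

lemma std_normal_integrals:
  shows "(LBINT z. std_normal_density z) = 1"
    and "(LBINT z. std_normal_density z * z\<^sup>2) = 1"
    and "(LBINT z. std_normal_density z * z ^ 4) = 3"
  using integral_std_normal_moment_even[of 1] integral_std_normal_moment_even[of 2]
  by (simp_all add: fact_numeral)

subsection \<open>The first-order error of the density\<close>

definition mass :: "nat \<Rightarrow> real" where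
  "mass N = (LBINT z. h_hat N z)"

text \<open>The kernel differs from a Gaussian by a function with an integrable majorant.\<close>

lemma integrable_h_hat:
  assumes "0 < N"
  shows "integrable lborel (h_hat N)"
proof -
  have "integrable lborel (\<lambda>z. real N * (h_hat N z - exp (- z\<^sup>2 / 2)))"
    by (rule Bochner_Integration.integrable_bound[OF integrable_dominating])
       (use h_hat_bound[OF assms] in \<open>auto intro: order_trans\<close>)
  then have "integrable lborel (\<lambda>z. h_hat N z - exp (- z\<^sup>2 / 2))"
    using assms by simp
  from Bochner_Integration.integrable_add[OF this integrable_exp_minus_square] show ?thesis by simp
qed

lemma integrable_p_hat: "0 < N \<Longrightarrow> integrable lborel (p_hat (Suc N))"
  using integrable_h_hat[of N] by (simp add: p_hat_eq cong: Bochner_Integration.integrable_cong)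

lemma mass_rate:
  "(\<lambda>N. real N * (mass N - sqrt (2 * pi))) \<longlonglongrightarrow> sqrt (2 * pi) * (3 / 4)"
proof -
  let ?f = "\<lambda>N z. real N * (h_hat N z - exp (- z\<^sup>2 / 2))"
  \<comment> \<open>The index is shifted because the majorant is available only for positive N;
    \<open>LIMSEQ_imp_Suc\<close> undoes the shift. The second and fourth moments 1 and 3 give 3/2 -
    3/4 = 3/4.\<close>
  have "(\<lambda>N. LBINT z. ?f (Suc N) z) \<longlonglongrightarrow> (LBINT z. exp (- z\<^sup>2 / 2) * (3 / 2 * z\<^sup>2 - z ^ 4 / 4))"
    by (rule integral_dominated_convergence[OF _ _ integrable_dominating])
       (simp, simp, intro AE_I2 h_hat_pointwise[THEN LIMSEQ_Suc],
        unfold real_norm_def, intro AE_I2 h_hat_bound zero_less_Suc)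
  also have "(LBINT z. exp (- z\<^sup>2 / 2) * (3 / 2 * z\<^sup>2 - z ^ 4 / 4)) =
      (LBINT z. sqrt (2 * pi) * (3 / 2 * (std_normal_density z * z\<^sup>2) - 1 / 4 * (std_normal_density z * z ^ 4)))"
    unfolding exp_eq_std_normal_density by (simp add: algebra_simps)
  also have "\<dots> = sqrt (2 * pi) * (3 / 4)"
    using integrable_std_normal_moment by (simp add: std_normal_integrals)
  also have "(\<lambda>N. LBINT z. ?f (Suc N) z) = (\<lambda>N. real (Suc N) * (mass (Suc N) - sqrt (2 * pi)))"
  proof
    fix N
    have "(LBINT z. ?f (Suc N) z) = real (Suc N) * (mass (Suc N) - (LBINT z. exp (- z\<^sup>2 / 2)))"
      using integrable_h_hat[of "Suc N"] integrable_exp_minus_square by (simp add: mass_def)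
    also have "(LBINT z::real. exp (- z\<^sup>2 / 2)) = sqrt (2 * pi)"
      unfolding exp_eq_std_normal_density by (simp add: std_normal_integrals)
    finally show "(LBINT z. ?f (Suc N) z) = real (Suc N) * (mass (Suc N) - sqrt (2 * pi))" .
  qed
  finally show ?thesis by (rule LIMSEQ_imp_Suc)
qed

lemma mass_limit: "mass \<longlonglongrightarrow> sqrt (2 * pi)"
proof -
  have "(\<lambda>N. inverse (real N) * (real N * (mass N - sqrt (2 * pi))) + sqrt (2 * pi))
      \<longlonglongrightarrow> 0 * (sqrt (2 * pi) * (3 / 4)) + sqrt (2 * pi)"
    by (intro tendsto_intros mass_rate lim_inverse_n)
  moreover have "\<forall>\<^sub>F N in sequentially.
      inverse (real N) * (real N * (mass N - sqrt (2 * pi))) + sqrt (2 * pi) = mass N"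
    using eventually_gt_at_top[of 0] by eventually_elim (simp add: field_simps)
  ultimately show ?thesis using Lim_transform_eventually by fastforce
qed

lemma inverse_mass_limit: "(\<lambda>N. 1 / mass N) \<longlonglongrightarrow> 1 / sqrt (2 * pi)"
  by (intro tendsto_intros mass_limit) simp

lemma inverse_mass_rate:
  "(\<lambda>N. real N * (1 / mass N - 1 / sqrt (2 * pi))) \<longlonglongrightarrow> - 3 / (4 * sqrt (2 * pi))"
proof -
  \<comment> \<open>This uses 1/m - 1/s = - (m - s) / (m s), valid once the mass m is
    nonzero.\<close>
  have "(\<lambda>N. - (real N * (mass N - sqrt (2 * pi))) * (1 / mass N) / sqrt (2 * pi))
      \<longlonglongrightarrow> - (sqrt (2 * pi) * (3 / 4)) * (1 / sqrt (2 * pi)) / sqrt (2 * pi)"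
    by (intro tendsto_intros mass_rate inverse_mass_limit) simp
  moreover have "\<forall>\<^sub>F N in sequentially.
      - (real N * (mass N - sqrt (2 * pi))) * (1 / mass N) / sqrt (2 * pi)
      = real N * (1 / mass N - 1 / sqrt (2 * pi))"
  proof -
    have "\<forall>\<^sub>F N in sequentially. mass N > 0"
      by (rule order_tendstoD[OF mass_limit]) simp
    then show ?thesis by eventually_elim (simp add: field_simps)
  qed
  ultimately have "(\<lambda>N. real N * (1 / mass N - 1 / sqrt (2 * pi)))
      \<longlonglongrightarrow> - (sqrt (2 * pi) * (3 / 4)) * (1 / sqrt (2 * pi)) / sqrt (2 * pi)"
    by (rule Lim_transform_eventually)
  then show ?thesis by (simp add: field_simps)
qed

definition p_err :: "nat \<Rightarrow> real \<Rightarrow> real" where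
  "p_err N z = real N * (p_hat (Suc N) z - std_normal_density z)"

definition p_err_limit :: "real \<Rightarrow> real" where
  "p_err_limit z = - (std_normal_density z * (z ^ 4 - 6 * z\<^sup>2 + 3)) / 4"

text \<open>The error splits into a kernel part and a normalisation part: h/m - e/s = (h - e)/m + e
  (1/m - 1/s). Each part has a known rate.\<close>

lemma p_err_eq:
  assumes "0 < N"
  shows "p_err N z = real N * (h_hat N z - exp (- z\<^sup>2 / 2)) * (1 / mass N)
    + exp (- z\<^sup>2 / 2) * (real N * (1 / mass N - 1 / sqrt (2 * pi)))"
  by (simp add: p_err_def p_hat_eq[OF assms] mass_def std_normal_density_def algebra_simps)

lemma p_err_pointwise: "(\<lambda>N. p_err N z) \<longlonglongrightarrow> p_err_limit z"
proof -
  let ?e = "exp (- z\<^sup>2 / 2)"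
  have "(\<lambda>N. real N * (h_hat N z - ?e) * (1 / mass N)
      + ?e * (real N * (1 / mass N - 1 / sqrt (2 * pi))))
    \<longlonglongrightarrow> ?e * (3 / 2 * z\<^sup>2 - z ^ 4 / 4) * (1 / sqrt (2 * pi)) + ?e * (- 3 / (4 * sqrt (2 * pi)))"
    by (intro tendsto_add tendsto_mult tendsto_const h_hat_pointwise inverse_mass_limit
        inverse_mass_rate)
  also have "?e * (3 / 2 * z\<^sup>2 - z ^ 4 / 4) * (1 / sqrt (2 * pi)) + ?e * (- 3 / (4 * sqrt (2 * pi)))
      = ?e * (1 / sqrt (2 * pi)) * (3 / 2 * z\<^sup>2 - z ^ 4 / 4 - 3 / 4)"
    by (simp add: algebra_simps)
  also have "\<dots> = p_err_limit z"
    unfolding exp_eq_std_normal_density p_err_limit_def by (simp add: algebra_simps)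
  finally show ?thesis
    by (rule Lim_transform_eventually)
       (rule eventually_mono[OF eventually_gt_at_top[of 0]], simp only: p_err_eq)
qed

text \<open>The two scalar factors in \<open>p_err_eq\<close> converge, hence are bounded by
  constants K and L; the functions of z have integrable majorants.\<close>

lemma p_err_dominated:
  obtains w where "integrable lborel w" "\<And>N z. 0 < N \<Longrightarrow> \<bar>p_err N z\<bar> \<le> w z"
proof -
  obtain K where K: "\<And>N. \<bar>1 / mass N\<bar> \<le> K"
    using convergent_imp_Bseq[OF convergentI[OF inverse_mass_limit]] unfolding Bseq_def real_norm_def by blast
  obtain L where L: "\<And>N. \<bar>real N * (1 / mass N - 1 / sqrt (2 * pi))\<bar> \<le> L"
    using convergent_imp_Bseq[OF convergentI[OF inverse_mass_rate]] unfolding Bseq_def real_norm_def by blast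
  show thesis
  proof
    show "integrable lborel (\<lambda>z. exp (- z\<^sup>2 / 8) * (4 * z\<^sup>2 + z ^ 4) * K + exp (- z\<^sup>2 / 2) * L)"
      by (intro Bochner_Integration.integrable_add integrable_mult_left integrable_dominating
          integrable_exp_minus_square)
    fix N :: nat and z :: real
    assume N: "0 < N"
    show "\<bar>p_err N z\<bar> \<le> exp (- z\<^sup>2 / 8) * (4 * z\<^sup>2 + z ^ 4) * K + exp (- z\<^sup>2 / 2) * L"
      unfolding p_err_eq[OF N]
    proof (rule order_trans[OF abs_triangle_ineq add_mono])
      show "\<bar>real N * (h_hat N z - exp (- z\<^sup>2 / 2)) * (1 / mass N)\<bar> \<le> exp (- z\<^sup>2 / 8) * (4 * z\<^sup>2 + z ^ 4) * K"
        unfolding abs_mult[of _ "1 / mass N"] by (intro mult_mono h_hat_bound N K) auto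
      show "\<bar>exp (- z\<^sup>2 / 2) * (real N * (1 / mass N - 1 / sqrt (2 * pi)))\<bar> \<le> exp (- z\<^sup>2 / 2) * L"
        unfolding abs_mult[of "exp _"] using L by (intro mult_mono) auto
    qed
  qed
qed

lemma borel_measurable_p_hat [measurable]: "p_hat n \<in> borel_measurable borel"
  unfolding p_hat_def[abs_def] p_def[abs_def] h_def[abs_def] by measurable

lemma borel_measurable_p_err [measurable]: "p_err N \<in> borel_measurable borel"
  unfolding p_err_def[abs_def] by measurable

lemma borel_measurable_p_err_limit [measurable]: "p_err_limit \<in> borel_measurable borel"
  unfolding p_err_limit_def[abs_def] by measurable

lemma p_err_integral_limit:
  assumes [measurable]: "A \<in> sets borel"
  shows "(\<lambda>N. LBINT z:A. p_err N z) \<longlonglongrightarrow> (LBINT z:A. p_err_limit z)"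
proof -
  obtain w where w: "integrable lborel w" "\<And>N z. 0 < N \<Longrightarrow> \<bar>p_err N z\<bar> \<le> w z"
    using p_err_dominated by blast
  have "(\<lambda>N. LBINT z:A. p_err (Suc N) z) \<longlonglongrightarrow> (LBINT z:A. p_err_limit z)"
    unfolding set_lebesgue_integral_def
  proof (rule integral_dominated_convergence[OF _ _ w(1)])
    show "AE z in lborel. norm (indicator A z *\<^sub>R p_err (Suc N) z) \<le> w z" for N
      using w(2)[of "Suc N"] order_trans[OF abs_ge_zero w(2)[of "Suc N"]]
      by (auto simp: indicator_def)
  qed (auto intro!: tendsto_intros p_err_pointwise[THEN LIMSEQ_Suc])
  then show ?thesis by (rule LIMSEQ_imp_Suc)
qed

lemma p_err_norm_limit:
  "(\<lambda>N. LBINT z. \<bar>p_err N z\<bar>) \<longlonglongrightarrow> (LBINT z. \<bar>p_err_limit z\<bar>)"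
proof -
  obtain w where w: "integrable lborel w" "\<And>N z. 0 < N \<Longrightarrow> \<bar>p_err N z\<bar> \<le> w z"
    using p_err_dominated by blast
  have "(\<lambda>N. LBINT z. \<bar>p_err (Suc N) z\<bar>) \<longlonglongrightarrow> (LBINT z. \<bar>p_err_limit z\<bar>)"
    by (rule integral_dominated_convergence[OF _ _ w(1)])
       (auto simp: w(2) intro!: tendsto_intros p_err_pointwise[THEN LIMSEQ_Suc])
  then show ?thesis by (rule LIMSEQ_imp_Suc)
qed

subsection \<open>Integrals of the limit\<close>

text \<open>This is the Hermite relation (phi He_k)' = - phi He_(k+1) with k = 3, divided by
  4.\<close>

lemma p_err_limit_antiderivative:
  "((\<lambda>z. std_normal_density z * (z ^ 3 - 3 * z) / 4) has_real_derivative p_err_limit z) (at z within S)"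
proof -
  have "(std_normal_density has_real_derivative - z * std_normal_density z) (at z within S)"
  proof -
    have "((\<lambda>z. c * exp (- z\<^sup>2 / 2)) has_real_derivative - z * (c * exp (- z\<^sup>2 / 2))) (at z within S)" for c
      by (auto intro!: derivative_eq_intros)
    then show ?thesis unfolding std_normal_density_def .
  qed
  then show ?thesis
    unfolding p_err_limit_def
    by (auto intro!: derivative_eq_intros
        simp: field_simps power2_eq_square power3_eq_cube power4_eq_xxxx)
qed

lemma p_err_limit_integral:
  assumes "a \<le> b"
  shows "(LBINT z:{a..b}. p_err_limit z) =
    std_normal_density b * (b ^ 3 - 3 * b) / 4 - std_normal_density a * (a ^ 3 - 3 * a) / 4"
  unfolding set_lebesgue_integral_def
proof (rule integral_FTC_atLeastAtMost[OF assms])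
  show "continuous_on {a..b} p_err_limit"
    unfolding p_err_limit_def[abs_def] std_normal_density_def by (intro continuous_intros) auto
qed (use p_err_limit_antiderivative in \<open>simp add: has_real_derivative_iff_has_vector_derivative\<close>)

lemma std_normal_density_minus [simp]: "std_normal_density (- x) = std_normal_density x"
  by (simp add: std_normal_density_def)

text \<open>The line is cut at -x and x; the two tails agree by reflection and the total mass is
  1.\<close>

lemma Phi_symmetric:
  assumes "0 \<le> x"
  shows "2 * Phi x - 1 = (LBINT z:{- x..x}. std_normal_density z)"
proof -
  have int: "set_integrable lborel A std_normal_density" if "A \<in> sets borel" for A
    using integrable_mult_indicator[of A lborel std_normal_density] that by (simp add: set_integrable_def)
  have "(LBINT z:UNIV. std_normal_density z) =
      (LBINT z:{..x}. std_normal_density z) + (LBINT z:{x<..}. std_normal_density z)"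
    by (subst set_integral_Un[symmetric]) (auto intro!: int arg_cong2[where f = "set_lebesgue_integral lborel"])
  moreover have "(LBINT z:{..x}. std_normal_density z) =
      (LBINT z:{..<- x}. std_normal_density z) + (LBINT z:{- x..x}. std_normal_density z)"
    using assms
    by (subst set_integral_Un[symmetric]) (auto intro!: int arg_cong2[where f = "set_lebesgue_integral lborel"])
  moreover have "(LBINT z:{x<..}. std_normal_density z) = (LBINT z:{..<- x}. std_normal_density z)"
    by (subst set_integral_reflect) (auto simp: less_minus_iff intro!: arg_cong2[where f = "set_lebesgue_integral lborel"])
  ultimately show ?thesis
    by (simp add: Phi_def set_lebesgue_integral_def)
qed

section \<open>Convergence of the scaled errors\<close>

lemma F_hat_limit:
  assumes "0 \<le> x"
  shows "(\<lambda>n. real (n - 1) * (F_hat n x - (2 * Phi x - 1))) \<longlonglongrightarrow> H_hat x"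
proof -
  have "(\<lambda>N. LBINT z:{- x..x}. p_err (Suc N) z) \<longlonglongrightarrow> (LBINT z:{- x..x}. p_err_limit z)"
    by (intro p_err_integral_limit[THEN LIMSEQ_Suc]) simp
  \<comment> \<open>The antiderivative is odd, so the two endpoints contribute equally and 1/4
    becomes 1/2.\<close>
  also have "(LBINT z:{- x..x}. p_err_limit z) = H_hat x"
    using assms by (simp add: p_err_limit_integral H_hat_def field_simps)
  \<comment> \<open>Here n = N + 2, so that n - 1 = \<open>Suc N\<close> is positive and the
    truncated subtraction is harmless.\<close>
  also have "(\<lambda>N. LBINT z:{- x..x}. p_err (Suc N) z)
      = (\<lambda>N. real ((N + 2) - 1) * (F_hat (N + 2) x - (2 * Phi x - 1)))"
  proof
    fix N
    have "set_integrable lborel {- x..x} (p_hat (Suc (Suc N)))"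
      "set_integrable lborel {- x..x} std_normal_density"
      using integrable_mult_indicator[of "{- x..x}" lborel "p_hat (Suc (Suc N))"]
        integrable_mult_indicator[of "{- x..x}" lborel std_normal_density]
        integrable_p_hat[of "Suc N"] by (simp_all add: set_integrable_def)
    then show "(LBINT z:{- x..x}. p_err (Suc N) z) =
        real ((N + 2) - 1) * (F_hat (N + 2) x - (2 * Phi x - 1))"
      by (simp add: p_err_def F_hat_def Phi_symmetric[OF assms])
  qed
  finally show ?thesis by (rule LIMSEQ_offset)
qed

lemma d_TV_limit:
  "(\<lambda>n. real (n - 1) * d_TV (p_hat n) std_normal_density) \<longlonglongrightarrow> 1 / 2 * (LBINT z. \<bar>p_err_limit z\<bar>)"
proof -
  have "(\<lambda>N. 1 / 2 * (LBINT z. \<bar>p_err (Suc N) z\<bar>)) \<longlonglongrightarrow> 1 / 2 * (LBINT z. \<bar>p_err_limit z\<bar>)"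
    by (intro tendsto_intros p_err_norm_limit[THEN LIMSEQ_Suc])
  also have "(\<lambda>N. 1 / 2 * (LBINT z. \<bar>p_err (Suc N) z\<bar>))
      = (\<lambda>N. real ((N + 2) - 1) * d_TV (p_hat (N + 2)) std_normal_density)"
    by (simp add: p_err_def d_TV_def abs_mult del: of_nat_Suc)
  finally show ?thesis by (rule LIMSEQ_offset)
qed

section \<open>Sign and L1 norm of the limiting error\<close>

lemma b_squares:
  "b_minus\<^sup>2 = 3 - sqrt 6" "b_plus\<^sup>2 = 3 + sqrt 6" "0 < b_minus" "b_minus < b_plus"
proof -
  have "sqrt 6 < 3" by (rule real_less_lsqrt) auto
  then show "b_minus\<^sup>2 = 3 - sqrt 6" "b_plus\<^sup>2 = 3 + sqrt 6" "0 < b_minus" "b_minus < b_plus"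
    by (auto simp: b_minus_def b_plus_def)
qed

text \<open>As a quadratic in z^2, He_4 has the roots 3 - sqrt 6 and 3 + sqrt 6, and it is negative
  exactly between them.\<close>

lemma p_err_limit_pos_iff: "0 < p_err_limit z \<longleftrightarrow> b_minus < \<bar>z\<bar> \<and> \<bar>z\<bar> < b_plus"
proof -
  have "0 < p_err_limit z \<longleftrightarrow> std_normal_density z * (z ^ 4 - 6 * z\<^sup>2 + 3) < 0"
    by (simp add: p_err_limit_def)
  also have "\<dots> \<longleftrightarrow> z ^ 4 - 6 * z\<^sup>2 + 3 < 0"
    using normal_density_pos[of 1 0 z] by (simp add: mult_less_0_iff)
  also have "z ^ 4 - 6 * z\<^sup>2 + 3 = (z\<^sup>2 - b_minus\<^sup>2) * (z\<^sup>2 - b_plus\<^sup>2)"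
    unfolding b_squares by (simp add: algebra_simps power2_eq_square power4_eq_xxxx)
  also have "\<dots> < 0 \<longleftrightarrow> b_minus\<^sup>2 < z\<^sup>2 \<and> z\<^sup>2 < b_plus\<^sup>2"
    unfolding mult_less_0_iff using power_strict_mono[OF b_squares(4), of 2] b_squares(3) by auto
  also have "\<dots> \<longleftrightarrow> b_minus < \<bar>z\<bar> \<and> \<bar>z\<bar> < b_plus"
    using abs_le_square_iff[of z b_minus] abs_le_square_iff[of b_plus z] b_squares(3,4)
    by (auto simp flip: not_le)
  finally show ?thesis .
qed

text \<open>The moments 3, 1, 1 give -3/4 + 3/2 - 3/4 = 0, as expected for a limit of differences of
  probability densities.\<close>

lemma integrable_p_err_limit: "integrable lborel p_err_limit"
  and integral_p_err_limit: "(LBINT z. p_err_limit z) = 0"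
proof -
  have eq: "p_err_limit = (\<lambda>z. - 1 / 4 * (std_normal_density z * z ^ 4)
      + 3 / 2 * (std_normal_density z * z\<^sup>2) - 3 / 4 * std_normal_density z)"
    by (auto simp: p_err_limit_def field_simps)
  show "integrable lborel p_err_limit" "(LBINT z. p_err_limit z) = 0"
    unfolding eq using integrable_std_normal_moment by (simp_all add: std_normal_integrals)
qed

lemma p_err_limit_L1: "1 / 2 * (LBINT z. \<bar>p_err_limit z\<bar>) = C_TV_hat"
proof -
  let ?A = "{- b_plus..- b_minus}" and ?B = "{b_minus..b_plus}"
  have int: "integrable lborel (\<lambda>z. indicator A z *\<^sub>R p_err_limit z)" if "A \<in> sets borel" for A
    using integrable_mult_indicator[of A lborel p_err_limit] integrable_p_err_limit that by simp
  txt \<open>Since the integral of the limit vanishes, only its positive part has to be integrated.\<close>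
  have split: "\<bar>p_err_limit z\<bar> = 2 * (indicator ?A z *\<^sub>R p_err_limit z + indicator ?B z *\<^sub>R p_err_limit z) - p_err_limit z" for z
  proof -
    have disj: "\<not> (z \<in> ?A \<and> z \<in> ?B)" using b_squares(3) by auto
    have un: "z \<in> ?A \<or> z \<in> ?B \<longleftrightarrow> b_minus \<le> \<bar>z\<bar> \<and> \<bar>z\<bar> \<le> b_plus" using b_squares(3) by auto
    \<comment> \<open>The sign criterion is strict while \<open>?A\<close> and \<open>?B\<close> are
      closed, so the endpoints need a separate argument.\<close>
    have zero: "p_err_limit z = 0" if "\<bar>z\<bar> = b_minus \<or> \<bar>z\<bar> = b_plus"
    proof -
      have "z\<^sup>2 = 3 - sqrt 6 \<or> z\<^sup>2 = 3 + sqrt 6"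
        using that b_squares(1,2) by (metis power2_abs)
      then have "(z\<^sup>2 - 3)\<^sup>2 = 6" by auto
      then have "z ^ 4 - 6 * z\<^sup>2 + 3 = 0"
        by (simp add: power2_eq_square power4_eq_xxxx algebra_simps)
      then show ?thesis by (simp add: p_err_limit_def)
    qed
    show ?thesis
    proof (cases "z \<in> ?A \<or> z \<in> ?B")
      case True
      then have "0 \<le> p_err_limit z"
        using un zero p_err_limit_pos_iff[of z] by force
      then show ?thesis using True disj by (auto simp: indicator_def)
    next
      case False
      then have "p_err_limit z \<le> 0"
        using un p_err_limit_pos_iff[of z] by linarith
      then show ?thesis using False by (auto simp: indicator_def)
    qed
  qed
  have "(LBINT z. \<bar>p_err_limit z\<bar>) = 2 * ((LBINT z:?A. p_err_limit z) + (LBINT z:?B. p_err_limit z))"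
    unfolding split set_lebesgue_integral_def
    using int[of ?A] int[of ?B] integrable_p_err_limit by (simp add: integral_p_err_limit)
  also have "\<dots> = std_normal_density b_plus * (b_plus ^ 3 - 3 * b_plus)
      - std_normal_density b_minus * (b_minus ^ 3 - 3 * b_minus)"
    using b_squares(4) by (simp add: p_err_limit_integral field_simps)
  \<comment> \<open>The squares of \<open>b_plus\<close> and \<open>b_minus\<close> differ from 3 by
    plus and minus sqrt 6, which makes both cubics linear.\<close>
  also have "b_plus ^ 3 - 3 * b_plus = sqrt 6 * b_plus"
  proof -
    have "b_plus ^ 3 - 3 * b_plus = (b_plus\<^sup>2 - 3) * b_plus"
      by (simp add: power3_eq_cube power2_eq_square algebra_simps)
    then show ?thesis by (simp add: b_squares)
  qed
  also have "b_minus ^ 3 - 3 * b_minus = - sqrt 6 * b_minus"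
  proof -
    have "b_minus ^ 3 - 3 * b_minus = (b_minus\<^sup>2 - 3) * b_minus"
      by (simp add: power3_eq_cube power2_eq_square algebra_simps)
    then show ?thesis by (simp add: b_squares)
  qed
  finally show ?thesis by (simp add: C_TV_hat_def algebra_simps)
qed

subsection \<open>The numerical value\<close>

text \<open>The Lagrange remainder carries a factor exp t with |t| <= x <= 1, which lies between 0
  and e <= 3.\<close>

lemma exp_Maclaurin_bounds:
  fixes x :: real
  assumes "0 \<le> x" "x \<le> 1"
  shows "(\<Sum>m<n. x ^ m / fact m) \<le> exp x"
    and "exp x \<le> (\<Sum>m<n. x ^ m / fact m) + 3 / fact n * x ^ n"
proof -
  obtain t where t: "\<bar>t\<bar> \<le> \<bar>x\<bar>" "exp x = (\<Sum>m<n. x ^ m / fact m) + exp t / fact n * x ^ n"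
    using Maclaurin_exp_le by blast
  have "exp t \<le> exp 1" using t(1) assms by simp
  then have "exp t \<le> 3" using exp_le by linarith
  then have "exp t / fact n * x ^ n \<le> 3 / fact n * x ^ n"
    using assms by (intro mult_right_mono divide_right_mono) auto
  moreover have "0 \<le> exp t / fact n * x ^ n" using assms by simp
  ultimately show "(\<Sum>m<n. x ^ m / fact m) \<le> exp x"
    "exp x \<le> (\<Sum>m<n. x ^ m / fact m) + 3 / fact n * x ^ n"
    unfolding t(2) by linarith+
qed

lemma sqrt_6_bounds: "2.4494897427831 \<le> sqrt 6" "sqrt 6 \<le> 2.4494897427832"
  by (rule real_le_rsqrt real_le_lsqrt; simp add: power2_eq_square)+

lemma b_minus_bounds: "0.7419637843026 \<le> b_minus" "b_minus \<le> 0.7419637843028"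
  unfolding b_minus_def using sqrt_6_bounds
  by (rule_tac real_le_rsqrt real_le_lsqrt; simp add: power2_eq_square)+

lemma b_plus_bounds: "2.3344142183389 \<le> b_plus" "b_plus \<le> 2.3344142183390"
  unfolding b_plus_def using sqrt_6_bounds
  by (rule_tac real_le_rsqrt real_le_lsqrt; simp add: power2_eq_square)+

lemma exp_1_bounds: "2.7182818284590 \<le> exp (1::real)" "exp (1::real) \<le> 2.7182818284591"
  using exp_Maclaurin_bounds[of 1 17] by (simp_all add: lessThan_nat_numeral fact_numeral)

text \<open>The series bounds cover only [0, 1], so the enclosure of e is cubed.\<close>

lemma exp_3_bounds: "20.08553692318 \<le> exp (3::real)" "exp (3::real) \<le> 20.08553692319"
proof -
  have "exp (3::real) = exp 1 ^ 3"
    by (simp flip: exp_of_nat_mult)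
  moreover have "2.7182818284590 ^ 3 \<le> exp (1::real) ^ 3" "exp (1::real) ^ 3 \<le> 2.7182818284591 ^ 3"
    using exp_1_bounds by (intro power_mono; simp)+
  ultimately show "20.08553692318 \<le> exp (3::real)" "exp (3::real) \<le> 20.08553692319"
    by (simp_all add: power3_eq_cube)
qed

text \<open>The exponent is split into a fraction with small denominator, whose powers stay
  manageable, and a remainder d so small that four terms of the series suffice.\<close>

lemma exp_b_minus_bounds:
  "1.31686660235 \<le> exp (b_minus\<^sup>2 / 2)" "exp (b_minus\<^sup>2 / 2) \<le> 1.31686660236"
proof -
  txt \<open>\<open>11 / 40\<close> is a continued fraction convergent of \<open>(3 - sqrt 6) / 2\<close>.\<close>
  define d where "d = b_minus\<^sup>2 / 2 - 11 / 40"
  have d: "0.0002551286083 \<le> d" "d \<le> 0.0002551286085"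
    using sqrt_6_bounds unfolding d_def b_squares by simp_all
  have a: "1.3165306748675 \<le> exp (11 / 40 :: real)" "exp (11 / 40 :: real) \<le> 1.3165306748677"
    using exp_Maclaurin_bounds[of "11 / 40" 11]
    by (simp_all add: lessThan_nat_numeral fact_numeral power_divide)
  have "1.0002551611563 \<le> exp (0.0002551286083 :: real)" "exp (0.0002551286085 :: real) \<le> 1.0002551611566"
    using exp_Maclaurin_bounds[of "0.0002551286083" 4] exp_Maclaurin_bounds[of "0.0002551286085" 4]
    by (simp_all add: lessThan_nat_numeral fact_numeral power_divide)
  moreover have "exp 0.0002551286083 \<le> exp d" "exp d \<le> exp 0.0002551286085"
    using d by simp_all
  ultimately have "1.0002551611563 \<le> exp d" "exp d \<le> 1.0002551611566"
    by linarith+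
  then have "1.3165306748675 * 1.0002551611563 \<le> exp (11 / 40) * exp d"
    "exp (11 / 40) * exp d \<le> 1.3165306748677 * 1.0002551611566"
    using a by (intro mult_mono; simp)+
  moreover have "exp (11 / 40) * exp d = exp (b_minus\<^sup>2 / 2)"
    by (simp add: d_def flip: exp_add)
  ultimately show "1.31686660235 \<le> exp (b_minus\<^sup>2 / 2)" "exp (b_minus\<^sup>2 / 2) \<le> 1.31686660236"
    by simp_all
qed

lemma sqrt_2_pi_bounds: "2.50662827463 \<le> sqrt (2 * pi)" "sqrt (2 * pi) \<le> 2.506628274632"
  by (rule real_le_rsqrt real_le_lsqrt; use pi_approx in \<open>simp add: power2_eq_square\<close>)+

text \<open>Interval evaluation of the constant: the expression increases in \<open>s\<close>,
  \<open>b\<close>, \<open>c\<close>, \<open>e\<close> and decreases in \<open>f\<close>,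
  \<open>t\<close>, \<open>q\<close>. The variables \<open>e\<close> and \<open>f\<close> are kept
  apart although both stand for the same exponential, since it needs opposite bounds in its two
  places.\<close>

lemma C_TV_hat_form_mono:
  fixes s b c e f t q :: real
  assumes "0 < s" "s \<le> s'" "0 < b" "b \<le> b'" "0 < c" "c \<le> c'" "0 < e" "e \<le> e'"
    and "0 < f'" "f' \<le> f" "0 < t'" "t' \<le> t" "0 < q'" "q' \<le> q"
  shows "s / 2 * (b / f + c * e / t) / q \<le> s' / 2 * (b' / f' + c' * e' / t') / q'"
proof -
  have "b / f \<le> b' / f'" "c * e / t \<le> c' * e' / t'"
    using assms by (intro frac_le mult_mono; simp)+
  then have "s / 2 * (b / f + c * e / t) \<le> s' / 2 * (b' / f' + c' * e' / t')"
    using assms by (intro mult_mono add_mono) auto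
  moreover have "0 \<le> s' / 2 * (b' / f' + c' * e' / t')"
    using assms by simp
  ultimately show ?thesis
    using assms by (intro frac_le) auto
qed

lemma C_TV_hat_approx: "\<bar>C_TV_hat - 0.350075038\<bar> \<le> 5 / 10 ^ 10"
proof -
  define E where "E = exp (b_minus\<^sup>2 / 2)"
  have E: "1.31686660235 \<le> E" "E \<le> 1.31686660236"
    using exp_b_minus_bounds by (simp_all add: E_def)
  \<comment> \<open>The squares of \<open>b_minus\<close> and \<open>b_plus\<close> add up to 6, so
    both Gaussian values are expressed by E and exp 3.\<close>
  have "- b_plus\<^sup>2 / 2 = b_minus\<^sup>2 / 2 - 3"
    unfolding b_squares by (simp add: field_simps)
  then have "exp (- b_plus\<^sup>2 / 2) = E / exp 3"
    by (simp add: E_def exp_diff)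
  then have C: "C_TV_hat = sqrt 6 / 2 * (b_minus / E + b_plus * E / exp 3) / sqrt (2 * pi)"
    by (simp add: C_TV_hat_def std_normal_density_def E_def exp_minus field_simps)
  note bounds = sqrt_6_bounds b_minus_bounds b_plus_bounds E exp_3_bounds sqrt_2_pi_bounds
  have pos: "0 < sqrt 6" "0 < b_minus" "0 < b_plus" "0 < E" "0 < exp (3::real)" "0 < sqrt (2 * pi)"
    using b_squares(3,4) E by simp_all
  have "2.4494897427831 / 2 * (0.7419637843026 / 1.31686660236
      + 2.3344142183389 * 1.31686660235 / 20.08553692319) / 2.506628274632 \<le> C_TV_hat"
    unfolding C by (rule C_TV_hat_form_mono; (rule bounds pos | simp))
  moreover have "C_TV_hat \<le> 2.4494897427832 / 2 * (0.7419637843028 / 1.31686660235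
      + 2.3344142183390 * 1.31686660236 / 20.08553692318) / 2.50662827463"
    unfolding C by (rule C_TV_hat_form_mono; (rule bounds pos | simp))
  ultimately show ?thesis unfolding abs_le_iff by simp
qed

theorem corollary5p9:
  shows "(\<forall>x\<ge>0. (\<lambda>n. real (n - 1) * (F_hat n x - (2 * Phi x - 1))) \<longlonglongrightarrow> H_hat x)
    \<and> (\<lambda>n. real (n - 1) * d_TV (p_hat n) std_normal_density) \<longlonglongrightarrow> C_TV_hat
    \<and> \<bar>C_TV_hat - 0.350075038\<bar> \<le> 5 / 10 ^ 10"
  using F_hat_limit d_TV_limit C_TV_hat_approx unfolding p_err_limit_L1 by blast

end
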